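(* Let $p>1$, and let $\rho_1,\rho_2$ be non-vanishing positive functions on $\mathbb{R}$ such that the convolution $\rho_1\underset{T_c}{\overset{\gamma}{*}}\rho_2$ is well-defined. Then for any functions $F_1\in L_p(\mathbb{R},\rho_1)$ and $F_2\in L_p(\mathbb{R},\rho_2)$, $$\left\|\Big((F_1\rho_1)\underset{T_c}{\overset{\gamma}{*}}(F_2\rho_2)\Big)\cdot\Big(\rho_1\underset{T_c}{\overset{\gamma}{*}}\rho_2\Big)^{\frac1p-1}\right\|_{L_p(\mathbb{R})}\leq\left(\frac{1}{\sqrt{2\pi}}\right)^{1/p}\|F_1\|_{L_p(\mathbb{R},\rho_1)}\|F_2\|_{L_p(\mathbb{R},\rho_2)}.$$
   Context: For functions $f,g$ on $\mathbb{R}$, the iterated Fourier-cosine convolution with Gaussian weight $\gamma(y)=e^{-\frac12y^2}$ is $$\big(f\underset{T_c}{\overset{\gamma}{*}}g\big)(x):=\frac{1}{8\pi}\int_{\mathbb{R}^2}f(u)g(v)G(x,u,v)\,du\,dv,\quad x\in\mathbb{R},$$ where $$G(x,u,v)=e^{-\frac12(x+u+v)^2}+e^{-\frac12(x+u-v)^2}+e^{-\frac12(x-u+v)^2}+e^{-\frac12(x-u-v)^2}.$$ It is well-defined when the defining integral converges. For a positive function $\rho$ on $\mathbb{R}$, $L_p(\mathbb{R},\rho)$ is the weighted Lebesgue space with norm $\|F\|_{L_p(\mathbb{R},\rho)}=\big\{\int_{\mathbb{R}}|F(x)|^p\rho(x)\,dx\big\}^{1/p}<\infty$. Products such as $F_1\rho_1$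 are pointwise. *)

theory Defs
  imports "HOL-Analysis.Analysis"
begin

definition gauss_kernel :: "real \<Rightarrow> real \<Rightarrow> real \<Rightarrow> real" where
  "gauss_kernel x u v =
     exp (- (1/2) * (x + u + v)^2) + exp (- (1/2) * (x + u - v)^2)
   + exp (- (1/2) * (x - u + v)^2) + exp (- (1/2) * (x - u - v)^2)"

(* The scalar type 'a is left polymorphic so that real-valued and complex-valued functions
   are both covered; the weights are always real-valued. *)

definition conv_integrand ::
  "(real \<Rightarrow> 'a) \<Rightarrow> (real \<Rightarrow> 'a) \<Rightarrow> real \<Rightarrow> real \<times> real \<Rightarrow> 'a::{real_normed_field, euclidean_space}"
  where "conv_integrand f g x = (\<lambda>(u, v). f u * g v * of_real (gauss_kernel x u v))"

definition conv_well_defined ::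
  "(real \<Rightarrow> 'a::{real_normed_field, euclidean_space}) \<Rightarrow> (real \<Rightarrow> 'a) \<Rightarrow> bool"
  where "conv_well_defined f g \<longleftrightarrow> (\<forall>x. integrable lebesgue (conv_integrand f g x))"

(* Meaningful only under conv_well_defined: the Bochner integral of a non-integrable function is 0. *)
definition conv ::
  "(real \<Rightarrow> 'a) \<Rightarrow> (real \<Rightarrow> 'a) \<Rightarrow> real \<Rightarrow> 'a::{real_normed_field, euclidean_space}"
  where "conv f g x = of_real (1 / (8 * pi)) * (\<integral>w. conv_integrand f g x w \<partial>lebesgue)"

definition Lp_space ::
  "real \<Rightarrow> (real \<Rightarrow> real) \<Rightarrow> (real \<Rightarrow> 'a::{real_normed_field, euclidean_space}) set"
  where "Lp_space p \<rho> = {F. F \<in> borel_measurable lebesgue \<and>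
           integrable lebesgue (\<lambda>x. norm (F x) powr p * \<rho> x)}"

(* Meaningful only for members of Lp_space p \<rho>; elsewhere the integral may default to 0. *)
definition Lp_norm ::
  "real \<Rightarrow> (real \<Rightarrow> real) \<Rightarrow> (real \<Rightarrow> 'a::{real_normed_field, euclidean_space}) \<Rightarrow> real"
  where "Lp_norm p \<rho> F = (\<integral>x. norm (F x) powr p * \<rho> x \<partial>lebesgue) powr (1 / p)"

end

theory Submission
  imports Defs "HOL-Probability.Distributions"
begin

text \<open>
  For fixed \<open>x\<close>, Jensen's inequality for the weight \<open>\<rho>1 u * \<rho>2 v * G x u v\<close> bounds the \<open>p\<close>-th power of the
  integrand on the left pointwise by the convolution of \<open>|F1|^p \<rho>1\<close> and \<open>|F2|^p \<rho>2\<close> at \<open>x\<close>; the exponent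
  \<open>1/p - 1\<close> of \<open>conv \<rho>1 \<rho>2\<close> is exactly what Jensen produces. Integrating over \<open>x\<close> and using
  \<open>\<integral> G x u v dx = 4 sqrt (2 pi)\<close>, Fubini's theorem gives the constant
  \<open>4 sqrt (2 pi) / (8 pi) = 1 / sqrt (2 pi)\<close>.
\<close>

section \<open>Borel representatives of functions measurable for a completed measure\<close>

text \<open>The preimages of a set under \<open>f\<close> and \<open>g\<close> differ only inside
  the exceptional null set, and a completed measure measures every set that differs from a
  measurable one by a null set.\<close>

lemma borel_measurable_completion_AE_eq:
  assumes g: "g \<in> borel_measurable M" and eq: "AE x in M. f x = g x"
  shows "f \<in> borel_measurable (completion M)"
proof (rule measurableI)
  fix A :: "'b set" assume A: "A \<in> sets borel"
  show "f -` A \<inter> space (completion M) \<in> sets (completion M)"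
  proof (rule completion.in_sets_AE)
    show "g -` A \<inter> space M \<in> sets (completion M)"
      using measurable_sets[OF g A] by (rule sets_completionI_sets)
    show "AE x in completion M. x \<in> g -` A \<inter> space M \<longleftrightarrow> x \<in> f -` A \<inter> space (completion M)"
      using AE_completion[OF eq] by eventually_elim auto
  qed auto
qed auto

text \<open>The real-valued case applies to each coordinate; as \<open>Basis\<close> is finite, the
  exceptional null sets combine into one.\<close>

lemma completion_ex_borel_measurable_euclidean:
  fixes f :: "'b \<Rightarrow> 'a::euclidean_space"
  assumes f: "f \<in> borel_measurable (completion M)"
  obtains g where "g \<in> borel_measurable M" "AE x in M. f x = g x"
proof -
  have "\<forall>i\<in>Basis. \<exists>h\<in>borel_measurable M. AE x in M. f x \<bullet> i = h x"
    using f by (intro ballI completion_ex_borel_measurable_real) simp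
  then obtain h where h: "\<And>i. i \<in> Basis \<Longrightarrow> h i \<in> borel_measurable M"
      "\<And>i. i \<in> Basis \<Longrightarrow> AE x in M. f x \<bullet> i = h i x"
    by metis
  show thesis
  proof
    show "(\<lambda>x. \<Sum>i\<in>Basis. h i x *\<^sub>R i) \<in> borel_measurable M"
      using h(1) by measurable
    have "AE x in M. \<forall>i\<in>Basis. f x \<bullet> i = h i x"
      using h(2) by (intro AE_finite_allI) auto
    then show "AE x in M. f x = (\<Sum>i\<in>Basis. h i x *\<^sub>R i)"
      by eventually_elim (metis (no_types, lifting) euclidean_representation sum.cong)
  qed
qed

text \<open>Fubini's theorem is used for \<open>lborel\<close>, whose products are again
  \<open>lborel\<close>, while \<open>lebesgue\<close> on the plane is only the completion of such a
  product; this carries integrals from one to the other. If neither function is integrable, both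
  integrals default to 0, so the second equation still holds.\<close>

lemma integrable_completion_AE_eq:
  fixes f :: "'b \<Rightarrow> 'a::{banach, second_countable_topology}"
  assumes g: "g \<in> borel_measurable M" and eq: "AE x in M. f x = g x"
  shows "integrable (completion M) f \<longleftrightarrow> integrable M g"
    and "(\<integral>x. f x \<partial>completion M) = (\<integral>x. g x \<partial>M)"
proof -
  have g': "g \<in> borel_measurable (completion M)"
    using g by (rule measurable_completion)
  have f: "f \<in> borel_measurable (completion M)"
    using g eq by (rule borel_measurable_completion_AE_eq)
  have eq': "AE x in completion M. f x = g x"
    using eq by (rule AE_completion)
  show "integrable (completion M) f \<longleftrightarrow> integrable M g"
    using integrable_cong_AE[OF f g' eq'] integrable_completion[OF g] by simp
  show "(\<integral>x. f x \<partial>completion M) = (\<integral>x. g x \<partial>M)"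
    using integral_cong_AE[OF f g' eq'] integral_completion[OF g] by simp
qed

section \<open>Projections and tensor products on product spaces\<close>

text \<open>A null set \<open>N\<close> of the first factor lifts to the cylinder
  \<open>N \<times> UNIV\<close>, which is null because \<open>0 * \<infinity> = 0\<close> for
  measures.\<close>

lemma AE_lborel_fst:
  assumes "AE u in (lborel :: 'a::euclidean_space measure). P u"
  shows "AE w in (lborel :: ('a \<times> 'b::euclidean_space) measure). P (fst w)"
proof -
  obtain N where N: "N \<in> null_sets lborel" "{u. \<not> P u} \<subseteq> N"
    using assms unfolding eventually_ae_filter by auto
  have "N \<times> UNIV \<in> null_sets (lborel \<Otimes>\<^sub>M (lborel :: 'b measure))"
    using N(1) by (intro lborel.times_in_null_sets1) auto
  then show ?thesis
    using N(2) unfolding lborel_prod by (intro AE_I'[of "N \<times> UNIV"]) auto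
qed

lemma AE_lborel_snd:
  assumes "AE v in (lborel :: 'b::euclidean_space measure). P v"
  shows "AE w in (lborel :: ('a::euclidean_space \<times> 'b) measure). P (snd w)"
proof -
  obtain N where N: "N \<in> null_sets lborel" "{u. \<not> P u} \<subseteq> N"
    using assms unfolding eventually_ae_filter by auto
  have "UNIV \<times> N \<in> null_sets ((lborel :: 'a measure) \<Otimes>\<^sub>M lborel)"
    using N(1) by (intro lborel.times_in_null_sets2) auto
  then show ?thesis
    using N(2) unfolding lborel_prod by (intro AE_I'[of "UNIV \<times> N"]) auto
qed

lemma measurable_borel_fst_snd:
  "fst \<in> (borel :: ('a::second_countable_topology \<times> 'b::second_countable_topology) measure) \<rightarrow>\<^sub>M borel"
  "snd \<in> (borel :: ('a \<times> 'b) measure) \<rightarrow>\<^sub>M borel"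
  by (simp_all flip: borel_prod)

text \<open>A Borel representative composes with the Borel map \<open>fst\<close>, and the set where
  it differs from \<open>f\<close> pulls back to a null cylinder.\<close>

lemma borel_measurable_lebesgue_fst:
  fixes f :: "'a::euclidean_space \<Rightarrow> 'c::euclidean_space"
  assumes "f \<in> borel_measurable lebesgue"
  shows "(\<lambda>w :: 'a \<times> 'b::euclidean_space. f (fst w)) \<in> borel_measurable lebesgue"
proof -
  obtain g where g: "g \<in> borel_measurable lborel" "AE u in lborel. f u = g u"
    using assms by (rule completion_ex_borel_measurable_euclidean)
  have "(\<lambda>w :: 'a \<times> 'b. g (fst w)) \<in> borel_measurable lborel"
    using measurable_compose[OF measurable_borel_fst_snd(1) g(1)[simplified]] by simp
  then show ?thesis
    using AE_lborel_fst[OF g(2)] by (rule borel_measurable_completion_AE_eq)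
qed

lemma borel_measurable_lebesgue_snd:
  fixes f :: "'b::euclidean_space \<Rightarrow> 'c::euclidean_space"
  assumes "f \<in> borel_measurable lebesgue"
  shows "(\<lambda>w :: 'a::euclidean_space \<times> 'b. f (snd w)) \<in> borel_measurable lebesgue"
proof -
  obtain g where g: "g \<in> borel_measurable lborel" "AE u in lborel. f u = g u"
    using assms by (rule completion_ex_borel_measurable_euclidean)
  have "(\<lambda>w :: 'a \<times> 'b. g (snd w)) \<in> borel_measurable lborel"
    using measurable_compose[OF measurable_borel_fst_snd(2) g(1)[simplified]] by simp
  then show ?thesis
    using AE_lborel_snd[OF g(2)] by (rule borel_measurable_completion_AE_eq)
qed

text \<open>Fubini's theorem applies to Borel representatives of the two factors; replacing both
  changes the product function only on a union of two null cylinders.\<close>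

lemma integral_lebesgue_tensor:
  fixes f :: "'a::euclidean_space \<Rightarrow> real" and g :: "'b::euclidean_space \<Rightarrow> real"
  assumes f: "integrable lebesgue f" and g: "integrable lebesgue g"
  shows "integrable lebesgue (\<lambda>w. f (fst w) * g (snd w))" (is ?I)
    and "(\<integral>w. f (fst w) * g (snd w) \<partial>lebesgue) = (\<integral>u. f u \<partial>lebesgue) * (\<integral>v. g v \<partial>lebesgue)" (is ?E)
proof -
  obtain f' where f': "f' \<in> borel_measurable lborel" "AE u in lborel. f u = f' u"
    using borel_measurable_integrable[OF f] by (rule completion_ex_borel_measurable_euclidean)
  obtain g' where g': "g' \<in> borel_measurable lborel" "AE v in lborel. g v = g' v"
    using borel_measurable_integrable[OF g] by (rule completion_ex_borel_measurable_euclidean)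
  have f'_int: "integrable lborel f'" and g'_int: "integrable lborel g'"
    using f g integrable_completion_AE_eq(1)[OF f'] integrable_completion_AE_eq(1)[OF g'] by auto
  have meas: "(\<lambda>w. f' (fst w) * g' (snd w)) \<in> borel_measurable lborel"
    using f'(1) g'(1)
    by (auto intro!: borel_measurable_times measurable_compose[OF measurable_borel_fst_snd(1)]
        measurable_compose[OF measurable_borel_fst_snd(2)])
  note [measurable] = f'(1) g'(1)
  have eq: "AE w in lborel. f (fst w) * g (snd w) = f' (fst w) * g' (snd w)"
    using AE_lborel_fst[OF f'(2), where 'b='b] AE_lborel_snd[OF g'(2), where 'a='a]
    by eventually_elim simp
  have int: "integrable (lborel \<Otimes>\<^sub>M lborel) (\<lambda>(u, v). f' u * g' v)"
    by (rule lborel_pair.Fubini_integrable) (auto simp: abs_mult f'_int g'_int)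
  show ?I
    using int integrable_completion_AE_eq(1)[OF meas eq]
    by (simp add: lborel_prod case_prod_beta')
  show ?E
    using lborel_pair.integral_fst[OF int] integrable_completion_AE_eq(2)[OF meas eq]
      integrable_completion_AE_eq(2)[OF f'] integrable_completion_AE_eq(2)[OF g']
    by (simp add: lborel_prod case_prod_beta')
qed

section \<open>The Gaussian kernel\<close>

lemma gauss_kernel_pos: "gauss_kernel x u v > 0"
  unfolding gauss_kernel_def by (intro add_pos_pos) auto

lemma gauss_kernel_le: "gauss_kernel x u v \<le> 4"
proof -
  have "exp (- (1/2) * a\<^sup>2) \<le> 1" for a :: real
    by simp
  from this[of "x + u + v"] this[of "x + u - v"] this[of "x - u + v"] this[of "x - u - v"]
  show ?thesis
    unfolding gauss_kernel_def by linarith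
qed

text \<open>The two uncurried orders serve the integral over \<open>w\<close> with parameter
  \<open>x\<close> and the exchange of integrals, where \<open>x\<close> is the inner
  variable.\<close>

lemma borel_measurable_gauss_kernel [measurable]:
  "(\<lambda>(x, w). gauss_kernel x (fst w) (snd w)) \<in> borel_measurable (borel \<Otimes>\<^sub>M borel)"
  "(\<lambda>(w, x). gauss_kernel x (fst w) (snd w)) \<in> borel_measurable (borel \<Otimes>\<^sub>M borel)"
  "(\<lambda>w. gauss_kernel x (fst w) (snd w)) \<in> borel_measurable borel"
  unfolding gauss_kernel_def borel_prod
  by (auto intro!: borel_measurable_continuous_onI continuous_intros simp: case_prod_beta')

text \<open>Up to the factor \<open>sqrt (2 * pi)\<close> the integrand is the normal density with
  mean \<open>- a\<close> and variance 1.\<close>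

lemma gaussian_has_integral:
  "has_bochner_integral lborel (\<lambda>x :: real. exp (- (1/2) * (x + a)\<^sup>2)) (sqrt (2 * pi))"
proof -
  have "has_bochner_integral lborel (normal_density (- a) 1) 1"
    by (simp add: has_bochner_integral_iff integrable_normal_density integral_normal_density)
  then have "has_bochner_integral lborel (\<lambda>x. sqrt (2 * pi) * normal_density (- a) 1 x)
      (sqrt (2 * pi) * 1)"
    by (intro has_bochner_integral_mult_right) auto
  then show ?thesis
    by (simp add: normal_density_def)
qed

text \<open>For fixed \<open>u\<close> and \<open>v\<close> the kernel is a sum of four translates
  in \<open>x\<close> of one Gaussian, so its integral does not depend on \<open>u\<close> and
  \<open>v\<close>.\<close>

lemma gauss_kernel_has_integral:
  "has_bochner_integral lborel (\<lambda>x. gauss_kernel x u v) (4 * sqrt (2 * pi))"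
proof -
  have "has_bochner_integral lborel (\<lambda>x. gauss_kernel x u v)
      (sqrt (2 * pi) + sqrt (2 * pi) + sqrt (2 * pi) + sqrt (2 * pi))"
    unfolding gauss_kernel_def
    using gaussian_has_integral[of "u + v"] gaussian_has_integral[of "u - v"]
      gaussian_has_integral[of "- u + v"] gaussian_has_integral[of "- u - v"]
    by (intro has_bochner_integral_add) (simp_all add: algebra_simps)
  then show ?thesis
    by simp
qed

section \<open>Integrating functions on the plane against the kernel\<close>

text \<open>A Borel representative of \<open>\<psi>\<close> leaves the integral unchanged for every
  \<open>x\<close> and makes the integrand jointly measurable in \<open>x\<close> and
  \<open>w\<close>. This is what makes both convolutions measurable functions of
  \<open>x\<close>.\<close>

lemma gauss_transform_measurable:
  fixes \<psi> :: "real \<times> real \<Rightarrow> 'a::{real_normed_field, euclidean_space}"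
  assumes "\<psi> \<in> borel_measurable lebesgue"
  shows "(\<lambda>x. \<integral>w. \<psi> w * of_real (gauss_kernel x (fst w) (snd w)) \<partial>lebesgue) \<in> borel_measurable borel"
proof -
  obtain \<psi>' where \<psi>': "\<psi>' \<in> borel_measurable lborel" "AE w in lborel. \<psi> w = \<psi>' w"
    using assms by (rule completion_ex_borel_measurable_euclidean)
  note [measurable] = \<psi>'(1)
  have "(\<integral>w. \<psi> w * of_real (gauss_kernel x (fst w) (snd w)) \<partial>lebesgue)
      = (\<integral>w. \<psi>' w * of_real (gauss_kernel x (fst w) (snd w)) \<partial>lborel)" for x
  proof (rule integrable_completion_AE_eq(2))
    show "(\<lambda>w. \<psi>' w * of_real (gauss_kernel x (fst w) (snd w))) \<in> borel_measurable lborel"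
      by measurable
  qed (use \<psi>'(2) in eventually_elim, simp)
  moreover have "(\<lambda>x. \<integral>w. \<psi>' w * of_real (gauss_kernel x (fst w) (snd w)) \<partial>lborel) \<in> borel_measurable borel"
    by measurable
  ultimately show ?thesis
    by simp
qed

text \<open>The kernel is bounded by 4, so \<open>4 * \<psi>\<close> dominates.\<close>

lemma gauss_transform_integrable:
  fixes \<psi> :: "real \<times> real \<Rightarrow> real"
  assumes "integrable lebesgue \<psi>"
  shows "integrable lebesgue (\<lambda>w. \<psi> w * gauss_kernel x (fst w) (snd w))"
proof (rule Bochner_Integration.integrable_bound)
  show "integrable lebesgue (\<lambda>w. 4 * \<psi> w)"
    using assms by simp
  show "(\<lambda>w. \<psi> w * gauss_kernel x (fst w) (snd w)) \<in> borel_measurable lebesgue"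
    using borel_measurable_integrable[OF assms] by (rule borel_measurable_times) (rule measurable_completion, simp)
  have "\<bar>\<psi> w\<bar> * gauss_kernel x (fst w) (snd w) \<le> \<bar>\<psi> w\<bar> * 4" for w
    by (intro mult_left_mono gauss_kernel_le) simp
  then show "AE w in lebesgue. norm (\<psi> w * gauss_kernel x (fst w) (snd w)) \<le> norm (4 * \<psi> w)"
    using less_imp_le[OF gauss_kernel_pos] by (simp add: abs_mult mult.commute)
qed

text \<open>By Fubini's theorem the integration over \<open>x\<close> may come first; it contributes
  the same constant \<open>4 * sqrt (2 * pi)\<close> at every \<open>w\<close>.\<close>

lemma gauss_transform_has_integral:
  fixes \<psi> :: "real \<times> real \<Rightarrow> real"
  assumes \<psi>: "integrable lebesgue \<psi>"
  shows "has_bochner_integral lebesgue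
    (\<lambda>x. \<integral>w. \<psi> w * gauss_kernel x (fst w) (snd w) \<partial>lebesgue) (4 * sqrt (2 * pi) * (\<integral>w. \<psi> w \<partial>lebesgue))"
proof -
  define I where "I x = (\<integral>w. \<psi> w * gauss_kernel x (fst w) (snd w) \<partial>lebesgue)" for x
  obtain \<psi>' where \<psi>': "\<psi>' \<in> borel_measurable lborel" "AE w in lborel. \<psi> w = \<psi>' w"
    using borel_measurable_integrable[OF \<psi>] by (rule completion_ex_borel_measurable_euclidean)
  note [measurable] = \<psi>'(1)
  have \<psi>'_int: "integrable lborel \<psi>'"
    using \<psi> integrable_completion_AE_eq(1)[OF \<psi>'] by simp
  have I_eq: "I x = (\<integral>w. \<psi>' w * gauss_kernel x (fst w) (snd w) \<partial>lborel)" for x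
    unfolding I_def
  proof (rule integrable_completion_AE_eq(2))
    show "(\<lambda>w. \<psi>' w * gauss_kernel x (fst w) (snd w)) \<in> borel_measurable lborel"
      by measurable
  qed (use \<psi>'(2) in eventually_elim, simp)
  have K: "integrable lborel (\<lambda>x. gauss_kernel x u v)"
    "(\<integral>x. gauss_kernel x u v \<partial>lborel) = 4 * sqrt (2 * pi)" for u v
    using gauss_kernel_has_integral by (simp_all add: has_bochner_integral_iff)
  have int: "integrable (lborel \<Otimes>\<^sub>M lborel) (\<lambda>(w, x). \<psi>' w * gauss_kernel x (fst w) (snd w))"
    by (rule lborel_pair.Fubini_integrable)
      (auto simp: abs_mult \<psi>'_int K less_imp_le[OF gauss_kernel_pos])
  have "has_bochner_integral lborel I (4 * sqrt (2 * pi) * (\<integral>w. \<psi>' w \<partial>lborel))"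
    using lborel_pair.integrable_snd[OF int] lborel_pair.Fubini_integral[OF int]
    by (simp add: has_bochner_integral_iff I_eq[abs_def] K mult.commute)
  moreover have "I \<in> borel_measurable lborel"
    unfolding I_eq[abs_def] by measurable
  ultimately show ?thesis
    using integrable_completion_AE_eq(2)[OF \<psi>']
    unfolding I_def by (simp add: has_bochner_integral_iff integrable_completion integral_completion)
qed

section \<open>Jensen's inequality for powers\<close>

text \<open>By convexity a power function lies above its tangent at \<open>m\<close>. Young's
  inequality yields this without differentiation and with \<open>m = 0\<close> included.\<close>

lemma powr_ge_tangent:
  fixes p s m :: real
  assumes "p > 1" "s \<ge> 0" "m \<ge> 0"
  shows "m powr p + p * m powr (p - 1) * (s - m) \<le> s powr p"
proof -
  \<comment> \<open>The conjugate exponents are \<open>p\<close> and \<open>p / (p - 1)\<close>, so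
    that the power of the second factor collapses to \<open>m powr p\<close>.\<close>
  have "s * m powr (p - 1) \<le> s powr p / p + (m powr (p - 1)) powr (p / (p - 1)) / (p / (p - 1))"
    using assms by (intro Youngs_inequality) (auto simp: field_simps)
  also have "(m powr (p - 1)) powr (p / (p - 1)) = m powr p"
    using assms by (simp add: powr_powr)
  finally have "p * (s * m powr (p - 1)) \<le> s powr p + (p - 1) * m powr p"
    using assms by (simp add: field_simps)
  moreover have "m powr (p - 1) * m = m powr p"
    using assms by (cases "m = 0") (simp_all add: powr_diff)
  ultimately show ?thesis
    by (simp add: algebra_simps)
qed

text \<open>Jensen's inequality for the probability density \<open>w / W\<close>, where
  \<open>W\<close> is the total weight, multiplied through by \<open>W\<close>. The proof integrates
  the tangent line at the weighted mean of \<open>s\<close>.\<close>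

lemma integral_powr_weighted_le:
  fixes s w :: "'b \<Rightarrow> real"
  assumes p: "p > 1"
    and s: "\<And>x. s x \<ge> 0" and w: "\<And>x. w x \<ge> 0"
    and int: "integrable M w" "integrable M (\<lambda>x. s x * w x)" "integrable M (\<lambda>x. s x powr p * w x)"
    and pos: "(\<integral>x. w x \<partial>M) > 0"
  shows "(\<integral>x. s x * w x \<partial>M) powr p * (\<integral>x. w x \<partial>M) powr (1 - p) \<le> (\<integral>x. s x powr p * w x \<partial>M)"
proof -
  define W where "W = (\<integral>x. w x \<partial>M)"
  define A where "A = (\<integral>x. s x * w x \<partial>M)"
  define m where "m = A / W"
  have W: "W > 0" using pos by (simp add: W_def)
  have A: "A \<ge> 0" unfolding A_def using s w by (intro integral_nonneg_AE) auto
  have m: "m \<ge> 0" using W A by (simp add: m_def)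
  \<comment> \<open>\<open>?c\<close> is the constant term of the tangent line at the weighted mean
    \<open>m\<close>. As the line takes the value \<open>m powr p\<close> at \<open>m\<close>, its
    weighted integral is \<open>m powr p * W\<close>.\<close>
  let ?c = "m powr p - p * m powr (p - 1) * m"
  have "A powr p * W powr (1 - p) = m powr p * W"
    using W A by (simp add: m_def powr_divide powr_diff)
  also have "\<dots> = ?c * W + p * m powr (p - 1) * A"
    using W by (simp add: m_def field_simps)
  also have "\<dots> = (\<integral>x. ?c * w x + p * m powr (p - 1) * (s x * w x) \<partial>M)"
    using int by (simp add: W_def A_def)
  also have "\<dots> \<le> (\<integral>x. s x powr p * w x \<partial>M)"
  proof (rule integral_mono)
    fix x
    have "(m powr p + p * m powr (p - 1) * (s x - m)) * w x \<le> s x powr p * w x"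
      using powr_ge_tangent[OF p s m] w by (rule mult_right_mono)
    then show "?c * w x + p * m powr (p - 1) * (s x * w x) \<le> s x powr p * w x"
      by (simp add: algebra_simps)
  qed (use int in auto)
  finally show ?thesis
    by (simp add: A_def W_def)
qed

text \<open>A vanishing integral would force \<open>f = 0\<close> almost everywhere, which is
  impossible because the whole space is not a null set.\<close>

lemma integral_lebesgue_pos:
  fixes f :: "'b::euclidean_space \<Rightarrow> real"
  assumes f: "integrable lebesgue f" and pos: "\<And>x. f x > 0"
  shows "(\<integral>x. f x \<partial>lebesgue) > 0"
proof -
  have "(\<integral>x. f x \<partial>lebesgue) \<noteq> 0"
  proof
    assume "(\<integral>x. f x \<partial>lebesgue) = 0"
    then have "AE x in lebesgue. f x = 0"
      using f pos by (subst (asm) integral_nonneg_eq_0_iff_AE) (auto intro: less_imp_le)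
    then have "AE x in (lebesgue :: 'b measure). False"
      by eventually_elim (use pos in \<open>simp add: less_imp_neq[symmetric]\<close>)
    then have "AE x in (lborel :: 'b measure). False"
      by (simp only: AE_completion_iff)
    then show False
      by (simp add: trivial_limit_def[symmetric] ae_filter_eq_bot_iff)
  qed
  moreover have "(\<integral>x. f x \<partial>lebesgue) \<ge> 0"
    using pos by (intro integral_nonneg_AE) (auto intro: less_imp_le)
  ultimately show ?thesis by simp
qed

section \<open>The convolution inequality for weighted spaces\<close>

text \<open>A Bochner integral that does not converge has the value 0. The conclusion therefore
  includes the convergence of the convolution and the membership of \<open>H\<close> in its space,
  which give the norm bound its intended meaning.\<close>

theorem theorem3p1:
  fixes p :: real
    and \<rho>1 \<rho>2 :: "real \<Rightarrow> real"
    and F1 F2 :: "real \<Rightarrow> 'a::{real_normed_field, euclidean_space}"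
  assumes "p > 1"
    and "\<And>x. \<rho>1 x > 0" and "\<And>x. \<rho>2 x > 0"
    and "conv_well_defined \<rho>1 \<rho>2"
    and "F1 \<in> Lp_space p \<rho>1" and "F2 \<in> Lp_space p \<rho>2"
  shows "let f1 = (\<lambda>x. F1 x * of_real (\<rho>1 x));
             f2 = (\<lambda>x. F2 x * of_real (\<rho>2 x));
             H = (\<lambda>x. conv f1 f2 x * of_real (conv \<rho>1 \<rho>2 x powr (1 / p - 1)))
         in conv_well_defined f1 f2
            \<and> H \<in> Lp_space p (\<lambda>_. 1)
            \<and> Lp_norm p (\<lambda>_. 1) H
                \<le> (1 / sqrt (2 * pi)) powr (1 / p) * Lp_norm p \<rho>1 F1 * Lp_norm p \<rho>2 F2"
proof -
  have p: "p > 1" by fact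
  have \<rho>_pos: "\<rho>1 x > 0" "\<rho>2 x > 0" for x by fact+
  define K where "K x w = gauss_kernel x (fst w) (snd w)" for x and w :: "real \<times> real"
  define r where "r w = \<rho>1 (fst w) * \<rho>2 (snd w)" for w
  define \<phi> where "\<phi> w = norm (F1 (fst w)) * norm (F2 (snd w))" for w
  define \<Phi> where "\<Phi> w = \<phi> w powr p * r w" for w
  define g where "g w = F1 (fst w) * F2 (snd w) * of_real (r w)" for w
  define f1 where "f1 = (\<lambda>x. F1 x * of_real (\<rho>1 x))"
  define f2 where "f2 = (\<lambda>x. F2 x * of_real (\<rho>2 x))"
  define H where "H = (\<lambda>x. conv f1 f2 x * of_real (conv \<rho>1 \<rho>2 x powr (1 / p - 1)))"
  \<comment> \<open>\<open>A\<close>, \<open>W\<close> and \<open>B\<close> are the three integrals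
    in Jensen's inequality at a fixed \<open>x\<close>, for the function \<open>\<phi>\<close> and
    the weight \<open>r w * K x w\<close>.\<close>
  define A where "A x = (\<integral>w. \<phi> w * (r w * K x w) \<partial>lebesgue)" for x
  define W where "W x = (\<integral>w. r w * K x w \<partial>lebesgue)" for x
  define B where "B x = (\<integral>w. \<Phi> w * K x w \<partial>lebesgue)" for x
  define N1 where "N1 = (\<integral>x. norm (F1 x) powr p * \<rho>1 x \<partial>lebesgue)"
  define N2 where "N2 = (\<integral>x. norm (F2 x) powr p * \<rho>2 x \<partial>lebesgue)"
  have pos: "K x w > 0" "r w > 0" "\<phi> w \<ge> 0" for x w
    using \<rho>_pos by (simp_all add: K_def r_def \<phi>_def gauss_kernel_pos)
  have nonneg: "K x w \<ge> 0" "r w \<ge> 0" for x w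
    using less_imp_le[OF pos(1)] less_imp_le[OF pos(2)] by simp_all
  have F: "F1 \<in> borel_measurable lebesgue" "integrable lebesgue (\<lambda>x. norm (F1 x) powr p * \<rho>1 x)"
    "F2 \<in> borel_measurable lebesgue" "integrable lebesgue (\<lambda>x. norm (F2 x) powr p * \<rho>2 x)"
    using assms(5,6) by (simp_all add: Lp_space_def)

  \<comment> \<open>Measurability of the weights and of the integrands\<close>
  have ci_\<rho>: "conv_integrand \<rho>1 \<rho>2 x = (\<lambda>w. r w * K x w)" for x
    by (simp add: conv_integrand_def r_def K_def case_prod_beta')
  have ci_f: "conv_integrand f1 f2 x = (\<lambda>w. g w * of_real (K x w))" for x
    by (simp add: conv_integrand_def f1_def f2_def g_def r_def K_def case_prod_beta' ac_simps)
  have int_rK: "integrable lebesgue (\<lambda>w. r w * K x w)" for x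
    using assms(4) by (simp add: conv_well_defined_def ci_\<rho>)
  have K_meas: "K x \<in> borel_measurable lebesgue" for x
    unfolding K_def by (rule measurable_completion) simp
  \<comment> \<open>The weights are not assumed measurable; integrability against the nonvanishing kernel
     gives measurability of their tensor product, which suffices.\<close>
  have r_meas: "r \<in> borel_measurable lebesgue"
  proof -
    have "(\<lambda>w. r w * K 0 w / K 0 w) \<in> borel_measurable lebesgue"
      using borel_measurable_integrable[OF int_rK] K_meas by (rule borel_measurable_divide)
    moreover have "(\<lambda>w. r w * K 0 w / K 0 w) = r"
      using pos(1)[of 0] by (auto simp: fun_eq_iff less_imp_neq[symmetric])
    ultimately show ?thesis by simp
  qed
  have F_meas: "(\<lambda>w :: real \<times> real. F1 (fst w)) \<in> borel_measurable lebesgue"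
      "(\<lambda>w :: real \<times> real. F2 (snd w)) \<in> borel_measurable lebesgue"
    using F by (auto intro: borel_measurable_lebesgue_fst borel_measurable_lebesgue_snd)
  note [measurable] = K_meas r_meas F_meas
  have \<phi>_meas [measurable]: "\<phi> \<in> borel_measurable lebesgue"
    unfolding \<phi>_def by measurable
  have g_meas [measurable]: "g \<in> borel_measurable lebesgue"
    unfolding g_def by measurable

  \<comment> \<open>Integrability and convergence of the weighted convolution\<close>
  \<comment> \<open>The power distributes over the product, so \<open>\<Phi>\<close> is a tensor
    product and its integral splits into the \<open>p\<close>-th powers of the two norms.\<close>
  have \<Phi>_eq: "\<Phi> = (\<lambda>w. (norm (F1 (fst w)) powr p * \<rho>1 (fst w)) * (norm (F2 (snd w)) powr p * \<rho>2 (snd w)))"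
    by (simp add: \<Phi>_def \<phi>_def r_def powr_mult fun_eq_iff)
  have \<Phi>_int: "integrable lebesgue \<Phi>" and \<Phi>_val: "(\<integral>w. \<Phi> w \<partial>lebesgue) = N1 * N2"
    unfolding \<Phi>_eq N1_def N2_def using integral_lebesgue_tensor[OF F(2) F(4)] by simp_all
  have \<Phi>K_int: "integrable lebesgue (\<lambda>w. \<Phi> w * K x w)" for x
    unfolding K_def using \<Phi>_int by (rule gauss_transform_integrable)
  \<comment> \<open>The bound is \<open>t \<le> 1 + t powr p\<close> for \<open>t \<ge> 0\<close>:
    the term 1 is controlled by the convergence of the convolution of the weights, the term
    \<open>t powr p\<close> by the integrability of \<open>\<Phi>\<close>.\<close>
  have \<phi>rK_int: "integrable lebesgue (\<lambda>w. \<phi> w * (r w * K x w))" for x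
  proof (rule Bochner_Integration.integrable_bound)
    show "integrable lebesgue (\<lambda>w. r w * K x w + \<Phi> w * K x w)"
      using int_rK \<Phi>K_int by simp
    have "\<phi> w \<le> 1 + \<phi> w powr p" for w
    proof (cases "\<phi> w \<le> 1")
      case False
      then have "\<phi> w powr 1 \<le> \<phi> w powr p"
        using p by (intro powr_mono) auto
      then show ?thesis using False by simp
    qed (simp add: add_increasing2)
    then have "\<phi> w * (r w * K x w) \<le> (1 + \<phi> w powr p) * (r w * K x w)" for w
      using nonneg by (intro mult_right_mono) auto
    then have "\<phi> w * (r w * K x w) \<le> r w * K x w + \<Phi> w * K x w" for w
      by (simp add: \<Phi>_def algebra_simps)
    moreover have "0 \<le> \<phi> w * (r w * K x w)" for w
      using pos nonneg by simp
    ultimately show "AE w in lebesgue. norm (\<phi> w * (r w * K x w)) \<le> norm (r w * K x w + \<Phi> w * K x w)"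
      by (intro AE_I2) (smt (verit) real_norm_def)
  qed measurable
  have norm_g: "norm (g w * of_real (K x w)) = \<phi> w * (r w * K x w)" for x w
    using nonneg by (simp add: g_def \<phi>_def norm_mult)
  have gK_int: "integrable lebesgue (\<lambda>w. g w * of_real (K x w))" for x
  proof (rule Bochner_Integration.integrable_bound[OF \<phi>rK_int])
    show "AE w in lebesgue. norm (g w * of_real (K x w)) \<le> norm (\<phi> w * (r w * K x w))"
      unfolding norm_g by simp
  qed measurable
  have wd: "conv_well_defined f1 f2"
    by (simp add: conv_well_defined_def ci_f gK_int)

  \<comment> \<open>The pointwise bound on \<open>H\<close>\<close>
  \<comment> \<open>Strict positivity lets Jensen's inequality divide by the total weight and keeps
    negative powers of \<open>W x\<close> away from the default \<open>0 powr a = 0\<close>.\<close>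
  have W_pos: "W x > 0" for x
    unfolding W_def using int_rK pos by (intro integral_lebesgue_pos) auto
  have A_nonneg: "A x \<ge> 0" for x
    unfolding A_def using pos nonneg by (intro integral_nonneg_AE) auto
  have conv_\<rho>: "conv \<rho>1 \<rho>2 x = W x / (8 * pi)" for x
    by (simp add: conv_def ci_\<rho> W_def)
  \<comment> \<open>The triangle inequality for integrals reduces the scalar-valued convolution to
    the real integral \<open>A x\<close>.\<close>
  have conv_f: "norm (conv f1 f2 x) \<le> A x / (8 * pi)" for x
  proof -
    have "norm (conv f1 f2 x) = norm (\<integral>w. g w * of_real (K x w) \<partial>lebesgue) / (8 * pi)"
      by (simp add: conv_def ci_f norm_mult norm_divide)
    also have "\<dots> \<le> (\<integral>w. norm (g w * of_real (K x w)) \<partial>lebesgue) / (8 * pi)"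
      by (intro divide_right_mono integral_norm_bound) simp
    finally show ?thesis
      by (simp only: norm_g A_def)
  qed
  have AWB: "A x powr p * W x powr (1 - p) \<le> B x" for x
  proof -
    have "A x powr p * W x powr (1 - p) \<le> (\<integral>w. \<phi> w powr p * (r w * K x w) \<partial>lebesgue)"
      unfolding A_def W_def
      using p pos nonneg int_rK \<phi>rK_int \<Phi>K_int[of x] W_pos[of x]
      by (intro integral_powr_weighted_le) (auto simp: \<Phi>_def W_def mult.assoc)
    then show ?thesis
      by (simp add: B_def \<Phi>_def mult.assoc)
  qed
  have H_le: "norm (H x) powr p \<le> B x / (8 * pi)" for x
  proof -
    have "norm (H x) powr p = norm (conv f1 f2 x) powr p * (W x / (8 * pi)) powr ((1 / p - 1) * p)"
      by (simp add: H_def norm_mult conv_\<rho> powr_mult powr_powr)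
    also have "(1 / p - 1) * p = 1 - p"
      using p by (simp add: field_simps)
    also have "norm (conv f1 f2 x) powr p * (W x / (8 * pi)) powr (1 - p)
        \<le> (A x / (8 * pi)) powr p * (W x / (8 * pi)) powr (1 - p)"
      using p conv_f by (intro mult_right_mono powr_mono2) auto
    also have "\<dots> = A x powr p * W x powr (1 - p) / (8 * pi)"
    proof -
      \<comment> \<open>The factors \<open>1 / (8 * pi)\<close> occur with exponents
        \<open>p\<close> and \<open>1 - p\<close>, so exactly one of them survives.\<close>
      have "(8 * pi) powr p * (8 * pi) powr (1 - p) = 8 * pi"
        by (simp flip: powr_add)
      then show ?thesis
        using A_nonneg W_pos[of x] by (simp add: powr_divide)
    qed
    also have "\<dots> \<le> B x / (8 * pi)"
      using AWB by (intro divide_right_mono) auto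
    finally show ?thesis .
  qed
  have H_meas: "H \<in> borel_measurable lebesgue"
  proof -
    have "conv f1 f2 \<in> borel_measurable borel"
      using gauss_transform_measurable[OF g_meas] unfolding conv_def[abs_def] ci_f K_def by simp
    moreover have "conv \<rho>1 \<rho>2 \<in> borel_measurable borel"
      using gauss_transform_measurable[OF r_meas] unfolding conv_def[abs_def] ci_\<rho> K_def by simp
    ultimately have "H \<in> borel_measurable borel"
      unfolding H_def by measurable
    then show ?thesis
      by (intro measurable_completion) simp
  qed

  \<comment> \<open>Integration over \<open>x\<close> and the constant\<close>
  have B_int: "integrable lebesgue B" and B_val: "(\<integral>x. B x \<partial>lebesgue) = 4 * sqrt (2 * pi) * (N1 * N2)"
    using gauss_transform_has_integral[OF \<Phi>_int]
    by (simp_all add: has_bochner_integral_iff B_def[abs_def] K_def \<Phi>_val)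
  have H_int: "integrable lebesgue (\<lambda>x. norm (H x) powr p)"
  proof (rule Bochner_Integration.integrable_bound)
    show "integrable lebesgue (\<lambda>x. B x / (8 * pi))"
      using B_int by simp
    show "AE x in lebesgue. norm (norm (H x) powr p) \<le> norm (B x / (8 * pi))"
      using H_le by (intro AE_I2) (smt (verit) powr_ge_zero real_norm_def)
  qed (use H_meas in measurable)
  have "(\<integral>x. norm (H x) powr p \<partial>lebesgue) \<le> (\<integral>x. B x / (8 * pi) \<partial>lebesgue)"
    using H_int B_int H_le by (intro integral_mono) auto
  also have "\<dots> = 1 / sqrt (2 * pi) * (N1 * N2)"
  proof -
    \<comment> \<open>In terms of \<open>s\<close> one has \<open>8 * pi = 4 * s * s\<close>, so the
      constant \<open>4 * s / (8 * pi)\<close> is \<open>1 / s\<close>.\<close>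
    define s where "s = sqrt (2 * pi)"
    have s: "s > 0" "8 * pi = 4 * (s * s)"
      by (simp_all add: s_def)
    have "(\<integral>x. B x / (8 * pi) \<partial>lebesgue) = 4 * s * (N1 * N2) / (4 * (s * s))"
      by (simp add: B_val s(2) flip: s_def)
    then show ?thesis
      using s(1) by (simp flip: s_def)
  qed
  finally have "(\<integral>x. norm (H x) powr p \<partial>lebesgue) powr (1 / p)
      \<le> (1 / sqrt (2 * pi) * (N1 * N2)) powr (1 / p)"
    using p by (intro powr_mono2 integral_nonneg_AE) auto
  also have "\<dots> = (1 / sqrt (2 * pi)) powr (1 / p) * N1 powr (1 / p) * N2 powr (1 / p)"
    by (simp only: powr_mult mult.assoc)
  finally have "Lp_norm p (\<lambda>_. 1) H
      \<le> (1 / sqrt (2 * pi)) powr (1 / p) * Lp_norm p \<rho>1 F1 * Lp_norm p \<rho>2 F2"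
    by (simp add: Lp_norm_def N1_def N2_def)
  moreover have "H \<in> Lp_space p (\<lambda>_. 1)"
    using H_meas H_int by (simp add: Lp_space_def)
  ultimately show ?thesis
    using wd unfolding Let_def f1_def f2_def H_def by blast
qed

end
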